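(* Let $m\ge 2$ and let $n=4k+3\ge 3$ with $k$ an integer. Then $\chi_{lat}(mK_n)\le n+1$.
   Context: All graphs are finite and simple. For a graph $G$ with $p$ vertices and $q$ edges, a local antimagic total labeling of $G$ is a bijection $f:V(G)\cup E(G)\to\{1,2,\ldots,p+q\}$ such that $w_f(u)\neq w_f(v)$ for every edge $uv\in E(G)$, where $w_f(u)=f(u)+\sum_{uv\in E(G)}f(uv)$ is the weight of $u$ (the sum is over all edges incident to $u$). The local antimagic total chromatic number $\chi_{lat}(G)$ is the minimum, over all local antimagic total labelings $f$ of $G$, of the number of distinct values of $w_f$ on $V(G)$. (It is known that every graph has a local antimagic total labeling.) $mK_n$ denotes the disjoint union of $m$ copies of the complete graph $K_n$. *)

theory Defs
  imports Main "HOL-Library.Extended_Nat" "HOL-Library.Ramsey"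
begin

text \<open>A graph is given by its vertex set and its edge set; an edge is the two-element set of its
  endpoints.\<close>

type_synonym 'a graph = "'a set \<times> 'a set set"

abbreviation verts :: "'a graph \<Rightarrow> 'a set" where
  "verts G \<equiv> fst G"

abbreviation edges :: "'a graph \<Rightarrow> 'a set set" where
  "edges G \<equiv> snd G"

definition finite_simple_graph :: "'a graph \<Rightarrow> bool" where
  "finite_simple_graph G \<longleftrightarrow> finite (verts G) \<and> edges G \<subseteq> nsets (verts G) 2"

text \<open>Labels live on the disjoint union of vertices and edges: \<open>f (Inl v)\<close> is the label of the
  vertex \<open>v\<close>, and \<open>f (Inr e)\<close> that of the edge \<open>e\<close>.\<close>

definition weight :: "'a graph \<Rightarrow> ('a + 'a set \<Rightarrow> nat) \<Rightarrow> 'a \<Rightarrow> nat" where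
  "weight G f u = f (Inl u) + (\<Sum>e\<in>{e \<in> edges G. u \<in> e}. f (Inr e))"

definition local_antimagic_total_labeling :: "'a graph \<Rightarrow> ('a + 'a set \<Rightarrow> nat) \<Rightarrow> bool" where
  "local_antimagic_total_labeling G f \<longleftrightarrow>
     bij_betw f (verts G <+> edges G) {1..card (verts G) + card (edges G)} \<and>
     (\<forall>u v. {u, v} \<in> edges G \<longrightarrow> weight G f u \<noteq> weight G f v)"

text \<open>The minimum is taken in \<^typ>\<open>enat\<close>, where the infimum of a nonempty set is attained. A graph
  without a local antimagic total labeling would get the value \<open>\<infinity>\<close> (in \<^typ>\<open>nat\<close> it would get the
  junk value \<open>0\<close>), so an upper bound on this number entails that a labeling exists.\<close>

definition chi_lat :: "'a graph \<Rightarrow> enat" where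
  "chi_lat G = (INF f\<in>{f. local_antimagic_total_labeling G f}. enat (card (weight G f ` verts G)))"

definition complete_graph :: "nat \<Rightarrow> nat graph" where
  "complete_graph n = ({..<n}, nsets {..<n} 2)"

definition disjoint_copies :: "nat \<Rightarrow> 'a graph \<Rightarrow> (nat \<times> 'a) graph" where
  "disjoint_copies m G = ({..<m} \<times> verts G, {Pair i ` e | i e. i < m \<and> e \<in> edges G})"

lemma finite_simple_graph_complete_graph: "finite_simple_graph (complete_graph n)"
  by (simp add: finite_simple_graph_def complete_graph_def)

lemma finite_simple_graph_disjoint_copies:
  assumes "finite_simple_graph G"
  shows "finite_simple_graph (disjoint_copies m G)"
proof -
  have "Pair i ` e \<in> nsets ({..<m} \<times> verts G) 2" if "i < m" "e \<in> edges G" for i e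
  proof -
    have "e \<subseteq> verts G" "finite e" "card e = 2"
      using assms that by (auto simp: finite_simple_graph_def nsets_def)
    then show ?thesis
      using that by (auto simp: nsets_def card_image inj_on_def)
  qed
  then show ?thesis
    using assms by (auto simp: finite_simple_graph_def disjoint_copies_def)
qed

lemma chi_lat_le_iff:
  "chi_lat G \<le> enat c \<longleftrightarrow>
     (\<exists>f. local_antimagic_total_labeling G f \<and> card (weight G f ` verts G) \<le> c)"
proof
  let ?S = "{enat (card (weight G f ` verts G)) | f. local_antimagic_total_labeling G f}"
  have chi: "chi_lat G = Inf ?S"
    unfolding chi_lat_def by (rule arg_cong[where f = Inf]) auto
  assume le: "chi_lat G \<le> enat c"
  have "?S \<noteq> {}"
  proof
    assume "?S = {}"
    then have "chi_lat G = \<infinity>"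
      by (simp add: chi Inf_enat_def)
    with le show False by simp
  qed
  then have "Inf ?S \<in> ?S"
    by (meson wellorder_InfI ex_in_conv)
  then show "\<exists>f. local_antimagic_total_labeling G f \<and> card (weight G f ` verts G) \<le> c"
    using le unfolding chi by (smt (verit) enat_ord_simps(1) mem_Collect_eq)
next
  assume "\<exists>f. local_antimagic_total_labeling G f \<and> card (weight G f ` verts G) \<le> c"
  then show "chi_lat G \<le> enat c"
    unfolding chi_lat_def by (metis INF_lower2 enat_ord_simps(1) mem_Collect_eq)
qed

end

theory Submission
  imports Defs
begin

text \<open>
  Adding up the label of a vertex and the labels of its edges is adding up a row of a symmetric
  matrix: put the label of the vertex \<open>a\<close> of a copy of \<open>K\<^sub>n\<close> at the diagonal position \<open>(a, a)\<close> and the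
  label of the edge \<open>ab\<close> at the positions \<open>(a, b)\<close> and \<open>(b, a)\<close>. The \<open>m\<close> copies give matrices
  \<open>A\<^sub>0, \<dots>, A\<^sub>m\<^sub>-\<^sub>1\<close>, whose entries on and above the diagonal must use each of the labels exactly once.
  The labels below are such that each row sum is the same in all the matrices, while the row sums
  of a single matrix are pairwise distinct. So \<open>n\<close> weights occur.

  To keep the row sums fixed, every entry is an affine function of the index \<open>i\<close> of the copy, and
  the slopes in each row add up to zero (lemma \<open>entry_affine\<close>, \<open>row_sum_entry\<close>). Each row has one
  entry of slope \<open>-(n - 1)\<close>, and its other \<open>n - 1\<close> entries have slope \<open>1\<close>. The position of the steep
  entry is given by the permutation matrix of the transposition of the last two vertices: it is on
  the diagonal in the first \<open>n - 2\<close> rows, and at the edge joining the last two vertices in the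
  remaining two. That makes \<open>n - 1\<close> steep positions up to symmetry, as many as the modulus of their
  slope, so that their labels interleave to fill an interval of \<open>m (n - 1)\<close> consecutive integers. The
  positions of slope \<open>1\<close> fill an interval of \<open>m\<close> integers each (lemma \<open>entry_surj\<close>). It is this
  count that forces one pair of vertices off the diagonal: \<open>n\<close> steep diagonal positions would
  interleave with slope \<open>-n\<close>, which \<open>n - 1\<close> edges of slope \<open>1\<close> do not compensate.

  To make the row sums of one matrix distinct, the intervals are arranged so that the labels grow
  with the vertices: first all edges but the last one, in colexicographic order; then the steep
  positions; then the vertices \<open>n - 2\<close> and \<open>n - 1\<close>. For \<open>a < b\<close>, row \<open>b\<close> then exceeds row \<open>a\<close>
  entry by entry, apart from the edge that they share (lemma \<open>row_sum_less\<close>).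
\<close>

section \<open>The matrix of labels\<close>

text \<open>The number \<open>(n choose 2) - 1\<close> counts the edges of slope \<open>1\<close>; the term \<open>(b choose 2) + a\<close> is the
  colexicographic rank of an edge \<open>ab\<close> with \<open>a < b\<close>. For distinct vertices below \<open>n\<close>, the condition
  \<open>n - 2 \<le> min a b\<close> singles out the edge joining the last two. The steep positions take the room of
  \<open>n - 1\<close> intervals of length \<open>m\<close>, so \<open>((n choose 2) - 1) + (n - 1)\<close> intervals precede the vertex
  \<open>n - 2\<close>, and \<open>(n choose 2) + a\<close> precede \<open>a\<close> if \<open>a\<close> is one of the last two vertices.\<close>

definition entry :: "nat \<Rightarrow> nat \<Rightarrow> nat \<Rightarrow> nat \<Rightarrow> nat \<Rightarrow> nat" where
  "entry m n i a b =
     (if a \<noteq> b then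
        if n - 2 \<le> min a b then m * ((n choose 2) - 1) + (n - 1) * (m - 1 - i) + 1
        else m * ((max a b choose 2) + min a b) + i + 1
      else
        if a < n - 2 then m * ((n choose 2) - 1) + (n - 1) * (m - 1 - i) + (a + 2)
        else m * ((n choose 2) + a) + i + 1)"

lemma entry_commute: "entry m n i a b = entry m n i b a"
  by (simp add: entry_def min.commute max.commute)

lemma entry_min_max: "entry m n i (min a b) (max a b) = entry m n i a b"
  by (auto simp: entry_def min_def max_def)

lemma Suc_choose_two: "Suc b choose 2 = (b choose 2) + b"
  by (simp add: numeral_2_eq_2)

lemma colex_surj: "q < n choose 2 \<Longrightarrow> \<exists>a b. a < b \<and> b < n \<and> q = (b choose 2) + a"
proof (induction n)
  case 0
  then show ?case by (simp add: numeral_2_eq_2)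
next
  case (Suc n)
  show ?case
  proof (cases "q < n choose 2")
    case True
    with Suc.IH show ?thesis by (meson less_Suc_eq)
  next
    case False
    with Suc.prems have "q - (n choose 2) < n" "q = (n choose 2) + (q - (n choose 2))"
      by (auto simp: Suc_choose_two)
    then show ?thesis by blast
  qed
qed

lemma choose_two_mono: "b \<le> c \<Longrightarrow> b choose 2 \<le> c choose 2"
  by (induction rule: dec_induct) (auto simp: Suc_choose_two)

lemma colex_less:
  assumes "a < b" "b < c"
  shows "(b choose 2) + a < c choose 2"
  using choose_two_mono[of "Suc b" c] assms by (simp add: Suc_choose_two)

text \<open>Apart from the edge joining the last two vertices, which has the last rank, all ranks are below
  \<open>(n choose 2) - 1\<close>.\<close>

lemma colex_less_last:
  assumes "a < b" "b < n" "a < n - 2"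
  shows "(b choose 2) + a < (n choose 2) - 1"
proof -
  have "b choose 2 \<le> (n - 1) choose 2"
    using assms by (intro choose_two_mono) simp
  moreover have "n choose 2 = ((n - 1) choose 2) + (n - 1)"
    using assms Suc_choose_two[of "n - 1"] by simp
  ultimately show ?thesis using assms by linarith
qed

text \<open>A label is found by division with remainder in the interval that contains it: by \<open>m\<close> in the
  parts of slope \<open>1\<close>, and by \<open>n - 1\<close> in the interleaved part.\<close>

lemma entry_surj:
  assumes n: "n \<ge> 2" and x: "1 \<le> x" "x \<le> m * ((n choose 2) + n)"
  shows "\<exists>i<m. \<exists>a b. a \<le> b \<and> b < n \<and> x = entry m n i a b"
proof -
  define T where "T = (n choose 2) - 1"
  have "n choose 2 \<ge> 1"
    using choose_two_mono[OF n] by simp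
  then have T: "n choose 2 = T + 1" by (simp add: T_def)
  define y where "y = x - 1"
  have xy: "x = y + 1" and y: "y < m * (T + n + 1)"
    using x T by (auto simp: y_def algebra_simps)
  have m: "m > 0" using y by (cases m) auto
  consider "y < m * T" | "m * T \<le> y" "y < m * T + m * (n - 1)" | "m * T + m * (n - 1) \<le> y"
    by linarith
  then show ?thesis
  proof cases
    case 1
    then have q: "y div m < T" using m by (simp add: less_mult_imp_div_less mult.commute)
    then obtain a b where ab: "a < b" "b < n" "y div m = (b choose 2) + a"
      using colex_surj[of "y div m" n] T by auto
    have "a < n - 2"
    proof (rule ccontr)
      assume "\<not> a < n - 2"
      with ab have "a = n - 2" "b = n - 1" by auto
      with ab q T Suc_choose_two[of "n - 1"] n show False by simp
    qed
    with ab have "entry m n (y mod m) a b = m * (y div m) + y mod m + 1"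
      by (simp add: entry_def)
    also have "\<dots> = x" by (simp add: xy)
    finally show ?thesis using ab m by (metis less_imp_le mod_less_divisor)
  next
    case 2
    define z where "z = y - m * T"
    define i where "i = m - 1 - z div (n - 1)"
    have "z < m * (n - 1)" using 2 by (simp add: z_def)
    then have "z div (n - 1) < m" by (simp add: less_mult_imp_div_less)
    then have i: "i < m" "m - 1 - i = z div (n - 1)" by (auto simp: i_def)
    have r: "z mod (n - 1) < n - 1" using n by simp
    have "y = m * T + z" using 2 by (simp add: z_def)
    also have "z = (n - 1) * (m - 1 - i) + z mod (n - 1)"
      unfolding i(2) by (rule mult_div_mod_eq[symmetric])
    finally have x': "x = m * T + (n - 1) * (m - 1 - i) + z mod (n - 1) + 1"
      by (simp add: xy)
    \<comment> \<open>Remainder \<open>0\<close> belongs to the edge joining the last two vertices, remainder \<open>a + 1\<close> to the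
      vertex \<open>a\<close>.\<close>
    show ?thesis
    proof (cases "z mod (n - 1)")
      case 0
      then have "x = entry m n i (n - 2) (n - 1)"
      proof -
        have "n - 2 \<noteq> n - 1" "n - 2 \<le> min (n - 2) (n - 1)" using n by auto
        with 0 x' show ?thesis by (simp only: entry_def T_def) simp
      qed
      with i n show ?thesis by (intro exI[of _ i] conjI exI[of _ "n - 2"] exI[of _ "n - 1"]) auto
    next
      case (Suc a)
      then have "a < n - 2" using r by linarith
      then have "x = entry m n i a a"
        using x' Suc by (simp add: entry_def T_def)
      with i \<open>a < n - 2\<close> show ?thesis by (intro exI[of _ i] conjI exI[of _ a]) auto
    qed
  next
    case 3
    define z where "z = y - m * (T + (n - 1))"
    have yz: "y = m * (T + (n - 1)) + z" using 3 by (simp add: z_def algebra_simps)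
    have "m * (T + n + 1) = m * (T + (n - 1)) + m * 2"
      using n by (simp flip: distrib_left)
    then have "z < 2 * m" using y yz by linarith
    then have d: "z div m < 2" by (simp add: less_mult_imp_div_less)
    define a where "a = n - 2 + z div m"
    have a: "a < n" "\<not> a < n - 2" using d n by (auto simp: a_def)
    have "(n choose 2) + a = T + (n - 1) + z div m" using n T by (simp add: a_def)
    then have "entry m n (z mod m) a a = m * (T + (n - 1) + z div m) + z mod m + 1"
      using a by (simp add: entry_def)
    also have "\<dots> = x" by (simp add: xy yz distrib_left)
    finally show ?thesis using a m by (metis le_refl mod_less_divisor)
  qed
qed

section \<open>Row sums\<close>

definition row_sum :: "nat \<Rightarrow> nat \<Rightarrow> nat \<Rightarrow> nat \<Rightarrow> nat" where
  "row_sum m n i a = (\<Sum>b<n. entry m n i a b)"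

text \<open>The column of the steep entry of a row: the transposition of the last two vertices.\<close>

definition steep :: "nat \<Rightarrow> nat \<Rightarrow> nat" where
  "steep n a = (if a < n - 2 then a else if a = n - 2 then n - 1 else n - 2)"

lemma steep_less: "n \<ge> 2 \<Longrightarrow> a < n \<Longrightarrow> steep n a < n"
  by (auto simp: steep_def)

lemma entry_affine:
  assumes "n \<ge> 2" "a < n" "b < n" "i < m"
  shows "int (entry m n i a b) =
    int (entry m n 0 a b) + int i * (if b = steep n a then 1 - int n else 1)"
proof (cases "b = steep n a")
  case True
  have "int (m - 1 - i) = int (m - 1) - int i" "int (n - 1) = int n - 1"
    using assms by auto
  then have *: "int ((n - 1) * (m - 1 - i)) = int ((n - 1) * (m - 1)) + int i * (1 - int n)"
    unfolding of_nat_mult by algebra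
  \<comment> \<open>On the diagonal and off it, only the constant part of a steep entry differs.\<close>
  obtain c where "entry m n j a b = c + (n - 1) * (m - 1 - j)" for j
  proof (cases "a = b")
    case eq: True
    then have "a < n - 2" using True assms by (auto simp: steep_def split: if_splits)
    then show ?thesis
      using eq that[of "m * ((n choose 2) - 1) + (a + 2)"] by (simp add: entry_def)
  next
    case False
    then have "n - 2 \<le> min a b" using True assms by (auto simp: steep_def split: if_splits)
    then show ?thesis
      using False that[of "m * ((n choose 2) - 1) + 1"] by (simp add: entry_def)
  qed
  then show ?thesis using True * by (simp only: of_nat_add) simp
next
  case False
  have "a = b \<Longrightarrow> \<not> a < n - 2" "a \<noteq> b \<Longrightarrow> \<not> n - 2 \<le> min a b"
    using False assms by (auto simp: steep_def split: if_splits)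
  then have "\<exists>c. \<forall>j. entry m n j a b = c + j"
  proof (cases "a = b")
    case True
    with \<open>a = b \<Longrightarrow> \<not> a < n - 2\<close> show ?thesis
      by (intro exI[of _ "m * ((n choose 2) + a) + 1"]) (simp add: entry_def)
  next
    case False
    with \<open>a \<noteq> b \<Longrightarrow> \<not> n - 2 \<le> min a b\<close> have "\<not> n - 2 \<le> min a b" by blast
    with False have "entry m n j a b = m * ((max a b choose 2) + min a b) + j + 1" for j
      by (simp only: entry_def if_True if_False simp_thms)
    then show ?thesis by (intro exI[of _ "m * ((max a b choose 2) + min a b) + 1"]) simp
  qed
  then show ?thesis using False by auto
qed

text \<open>One slope \<open>1 - n\<close> and \<open>n - 1\<close> slopes \<open>1\<close> cancel.\<close>

lemma row_sum_entry:
  assumes "n \<ge> 2" "a < n" "i < m"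
  shows "row_sum m n i a = row_sum m n 0 a"
proof -
  have "(\<Sum>b<n. if b = steep n a then 1 - int n else 1)
      = (\<Sum>b<n. 1 - (if b = steep n a then int n else 0))"
    by (rule sum.cong) auto
  also have "\<dots> = 0"
    using steep_less[OF assms(1,2)] by (simp add: sum_subtractf)
  finally have slopes: "(\<Sum>b<n. if b = steep n a then 1 - int n else 1) = 0" .
  have "int (row_sum m n i a)
      = (\<Sum>b<n. int (entry m n 0 a b) + int i * (if b = steep n a then 1 - int n else 1))"
    unfolding row_sum_def of_nat_sum by (rule sum.cong[OF refl], rule entry_affine) (use assms in auto)
  also have "\<dots> = int (row_sum m n 0 a)"
    by (simp only: sum.distrib sum_distrib_left[symmetric] slopes) (simp add: row_sum_def)
  finally show ?thesis by simp
qed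

lemma mult_add_less:
  fixes m p q i :: nat
  assumes "p < q" "i < m"
  shows "m * p + i < m * q"
proof -
  have "m * p + i < m * Suc p" using assms by simp
  also have "\<dots> \<le> m * q" using assms by (intro mult_le_mono2) simp
  finally show ?thesis .
qed

lemma entry_less_offdiag:
  assumes "a < b" "b < n" "c < n" "c \<noteq> a" "c \<noteq> b" "i < m"
  shows "entry m n i a c < entry m n i b c"
proof -
  have small: "min a c < n - 2" using assms by auto
  have "(max a c choose 2) + min a c < (n choose 2) - 1"
    using small assms by (intro colex_less_last) auto
  then have last: "m * ((max a c choose 2) + min a c) + i < m * ((n choose 2) - 1)"
    using assms by (intro mult_add_less)
  have "(max a c choose 2) + min a c < (max b c choose 2) + min b c"
  proof (cases "c < b")
    case True
    then have "(max a c choose 2) + min a c < b choose 2"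
      using assms by (intro colex_less) auto
    with True show ?thesis by (simp add: max_def min_def)
  next
    case False
    with assms show ?thesis by (simp add: max_def min_def)
  qed
  then have "m * ((max a c choose 2) + min a c) < m * ((max b c choose 2) + min b c)"
    using assms by simp
  moreover have "entry m n i a c = m * ((max a c choose 2) + min a c) + i + 1"
  proof -
    have "\<not> n - 2 \<le> min a c" using small by linarith
    with assms show ?thesis by (simp only: entry_def) simp
  qed
  moreover have "m * ((n choose 2) - 1) + 1 \<le> entry m n i b c \<or>
      entry m n i b c = m * ((max b c choose 2) + min b c) + i + 1"
    using assms by (simp add: entry_def)
  ultimately show ?thesis
    using last by linarith
qed

lemma entry_less_diag:
  assumes "a < b" "b < n" "i < m"
  shows "entry m n i a a < entry m n i b b"
proof -
  have steep_block: "m * ((n choose 2) - 1) + (n - 1) * (m - 1 - i) + (a + 2)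
      < m * ((n choose 2) + b) + i + 1" if "a < n - 2" "\<not> b < n - 2"
  proof -
    have "n choose 2 \<ge> 1"
      using choose_two_mono[of 2 n] assms by simp
    then have "m * ((n choose 2) - 1) + m * (n - 1) = m * ((n choose 2) + (n - 2))"
      using assms by (simp flip: distrib_left)
    also have "\<dots> \<le> m * ((n choose 2) + b)"
      using that by (intro mult_le_mono2) linarith
    finally have "m * ((n choose 2) - 1) + m * (n - 1) \<le> m * ((n choose 2) + b)" .
    moreover have "(n - 1) * (m - 1 - i) + (n - 1) \<le> m * (n - 1)"
    proof -
      have "(n - 1) * Suc (m - 1 - i) \<le> (n - 1) * m"
        using assms by (intro mult_le_mono2) simp
      then show ?thesis by (simp add: mult.commute)
    qed
    ultimately show ?thesis using that assms by linarith
  qed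
  show ?thesis
  proof (cases "b < n - 2")
    case True
    with assms show ?thesis by (simp add: entry_def)
  next
    case False
    show ?thesis
    proof (cases "a < n - 2")
      case True
      with False steep_block show ?thesis by (simp add: entry_def)
    next
      case a: False
      have "m * ((n choose 2) + a) < m * ((n choose 2) + b)" using assms by simp
      with a False show ?thesis by (simp add: entry_def)
    qed
  qed
qed

text \<open>The edge \<open>ab\<close> contributes to both rows, in different columns. Once it is set aside, the rows
  compare column by column and diagonal to diagonal.\<close>

lemma row_sum_less:
  assumes "a < b" "b < n" "i < m"
  shows "row_sum m n i a < row_sum m n i b"
proof -
  let ?C = "{..<n} - {a, b}"
  have split: "row_sum m n i c = entry m n i c a + entry m n i c b + (\<Sum>d\<in>?C. entry m n i c d)" for c
  proof -
    have "{..<n} = insert a (insert b ?C)" using assms by auto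
    then have "row_sum m n i c = sum (entry m n i c) (insert a (insert b ?C))"
      unfolding row_sum_def by metis
    also have "\<dots> = entry m n i c a + entry m n i c b + (\<Sum>d\<in>?C. entry m n i c d)"
      using assms by simp
    finally show ?thesis .
  qed
  have "(\<Sum>d\<in>?C. entry m n i a d) \<le> (\<Sum>d\<in>?C. entry m n i b d)"
    using assms by (intro sum_mono) (auto intro!: less_imp_le entry_less_offdiag)
  with entry_less_diag[OF assms] show ?thesis
    by (simp add: split entry_commute[of m n i b a])
qed

section \<open>The labeling of the disjoint copies\<close>

text \<open>The projections of an edge recover its copy, as a set with one element, and its end points.\<close>

definition copies_labeling :: "nat \<Rightarrow> nat \<Rightarrow> (nat \<times> nat) + (nat \<times> nat) set \<Rightarrow> nat" where
  "copies_labeling m n x =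
     (case x of Inl (i, a) \<Rightarrow> entry m n i a a
              | Inr e \<Rightarrow> entry m n (Min (fst ` e)) (Min (snd ` e)) (Max (snd ` e)))"

lemma copies_labeling_vertex: "copies_labeling m n (Inl (i, a)) = entry m n i a a"
  by (simp add: copies_labeling_def)

lemma copies_labeling_edge: "copies_labeling m n (Inr {(i, a), (i, b)}) = entry m n i a b"
  by (simp add: copies_labeling_def entry_min_max)

lemma verts_copies: "verts (disjoint_copies m (complete_graph n)) = {..<m} \<times> {..<n}"
  by (simp add: disjoint_copies_def complete_graph_def)

lemma edges_copies:
  "edges (disjoint_copies m (complete_graph n))
     = {{(i, a), (i, b)} | i a b. i < m \<and> a < n \<and> b < n \<and> a \<noteq> b}"
  (is "?L = ?R")
proof
  show "?L \<subseteq> ?R"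
  proof
    fix e assume "e \<in> ?L"
    then obtain i e' where "i < m" "e' \<in> nsets {..<n} 2" "e = Pair i ` e'"
      by (auto simp: disjoint_copies_def complete_graph_def)
    moreover from this obtain a b where "e' = {a, b}" "a \<noteq> b" "a < n" "b < n"
      by (auto simp: nsets_def card_2_iff)
    ultimately show "e \<in> ?R" by auto
  qed
  show "?R \<subseteq> ?L"
  proof
    fix e assume "e \<in> ?R"
    then obtain i a b where *: "i < m" "a < n" "b < n" "a \<noteq> b" "e = {(i, a), (i, b)}"
      by auto
    then have "{a, b} \<in> nsets {..<n} 2" "e = Pair i ` {a, b}"
      by (auto simp: nsets_def)
    with \<open>i < m\<close> show "e \<in> ?L"
      unfolding disjoint_copies_def complete_graph_def snd_conv by blast
  qed
qed

lemma card_edges_copies: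
  "finite (edges (disjoint_copies m (complete_graph n)))"
  "card (edges (disjoint_copies m (complete_graph n))) = m * (n choose 2)"
proof -
  let ?p = "\<lambda>(i :: nat, e :: nat set). Pair i ` e"
  let ?D = "{..<m} \<times> nsets {..<n} 2"
  have E: "edges (disjoint_copies m (complete_graph n)) = ?p ` ?D"
    by (auto simp: disjoint_copies_def complete_graph_def)
  have inj: "inj_on ?p ?D"
  proof (rule inj_onI, clarify)
    fix i j d e
    assume d: "d \<in> nsets {..<n} 2" and eq: "Pair i ` d = Pair j ` e"
    have "d = e" using arg_cong[OF eq, of "image snd"] by (simp add: image_image)
    moreover have "d \<noteq> {}" using d by (auto simp: nsets_def)
    then have "i = j" using eq by blast
    ultimately show "i = j \<and> d = e" by simp
  qed
  show "finite (edges (disjoint_copies m (complete_graph n)))"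
    unfolding E by (simp add: finite_imp_finite_nsets)
  show "card (edges (disjoint_copies m (complete_graph n))) = m * (n choose 2)"
    unfolding E card_image[OF inj] by (simp add: card_cartesian_product)
qed

lemma weight_copies:
  assumes "i < m" "a < n"
  shows "weight (disjoint_copies m (complete_graph n)) (copies_labeling m n) (i, a) = row_sum m n i a"
proof -
  let ?e = "\<lambda>b. {(i, a), (i, b)}"
  have star: "{e \<in> edges (disjoint_copies m (complete_graph n)). (i, a) \<in> e} = ?e ` ({..<n} - {a})"
    using assms unfolding edges_copies by blast
  have "inj_on ?e ({..<n} - {a})"
    by (auto simp: inj_on_def doubleton_eq_iff)
  then have "(\<Sum>e\<in>{e \<in> edges (disjoint_copies m (complete_graph n)). (i, a) \<in> e}.
      copies_labeling m n (Inr e)) = (\<Sum>b\<in>{..<n} - {a}. entry m n i a b)"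
    unfolding star by (simp add: sum.reindex copies_labeling_edge)
  then show ?thesis
    using assms by (simp add: weight_def row_sum_def copies_labeling_vertex sum.remove[of _ a])
qed

text \<open>There are as many labels as vertices and edges, so it is enough that each label occurs.\<close>

lemma bij_betw_copies_labeling:
  fixes m n :: nat
  assumes "n \<ge> 2"
  defines "G \<equiv> disjoint_copies m (complete_graph n)"
  shows "bij_betw (copies_labeling m n) (verts G <+> edges G) {1..card (verts G) + card (edges G)}"
proof -
  let ?f = "copies_labeling m n"
  let ?D = "verts G <+> edges G" and ?I = "{1..card (verts G) + card (edges G)}"
  have fin: "finite (verts G)" "finite (edges G)"
    unfolding G_def by (simp add: verts_copies, rule card_edges_copies)
  have size: "card (verts G) + card (edges G) = m * ((n choose 2) + n)"
    by (simp add: G_def verts_copies card_edges_copies algebra_simps)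
  have card_D: "card ?D = card ?I"
    using fin by (simp add: card_Plus)
  have "?I \<subseteq> ?f ` ?D"
  proof
    fix x assume "x \<in> ?I"
    then obtain i a b where *: "i < m" "a \<le> b" "b < n" "x = entry m n i a b"
      using entry_surj[OF assms(1), of x m] by (auto simp: size)
    show "x \<in> ?f ` ?D"
    proof (cases "a = b")
      case True
      then have "x = ?f (Inl (i, a))" "Inl (i, a) \<in> ?D"
        using * by (auto simp: copies_labeling_vertex G_def verts_copies)
      then show ?thesis by (rule image_eqI)
    next
      case False
      with * have "{(i, a), (i, b)} \<in> edges G"
        unfolding G_def edges_copies by fastforce
      then have "Inr {(i, a), (i, b)} \<in> ?D" by (rule InrI)
      moreover have "x = ?f (Inr {(i, a), (i, b)})" by (simp add: copies_labeling_edge *)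
      ultimately show ?thesis by (rule rev_image_eqI)
    qed
  qed
  moreover have "card (?f ` ?D) \<le> card ?I"
    using card_image_le[of ?D ?f] fin card_D by simp
  ultimately have image: "?f ` ?D = ?I"
    using card_seteq[of "?f ` ?D" ?I] fin by simp
  then have "inj_on ?f ?D"
    using card_D fin by (intro eq_card_imp_inj_on) auto
  with image show ?thesis by (simp add: bij_betw_def)
qed

lemma chi_lat_copies_le:
  assumes "n \<ge> 2"
  shows "chi_lat (disjoint_copies m (complete_graph n)) \<le> enat n"
proof -
  let ?G = "disjoint_copies m (complete_graph n)" and ?f = "copies_labeling m n"
  have "weight ?G ?f u \<noteq> weight ?G ?f v" if "{u, v} \<in> edges ?G" for u v
  proof -
    obtain i a b where *: "i < m" "a < n" "b < n" "a \<noteq> b" "{u, v} = {(i, a), (i, b)}"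
      using \<open>{u, v} \<in> edges ?G\<close> unfolding edges_copies by blast
    then have "weight ?G ?f (i, a) \<noteq> weight ?G ?f (i, b)"
      using row_sum_less[of a b n i m] row_sum_less[of b a n i m]
      by (cases a b rule: linorder_cases) (simp_all add: weight_copies)
    with * show ?thesis by (auto simp: doubleton_eq_iff)
  qed
  with bij_betw_copies_labeling[OF assms] have "local_antimagic_total_labeling ?G ?f"
    by (simp add: local_antimagic_total_labeling_def)
  moreover have "weight ?G ?f ` verts ?G \<subseteq> row_sum m n 0 ` {..<n}"
  proof (rule image_subsetI)
    fix v assume "v \<in> verts ?G"
    then obtain i a where v: "v = (i, a)" "i < m" "a < n" by (auto simp: verts_copies)
    then have "weight ?G ?f v = row_sum m n 0 a"
      using row_sum_entry[OF assms, of a i m] by (simp add: weight_copies)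
    with v show "weight ?G ?f v \<in> row_sum m n 0 ` {..<n}" by simp
  qed
  then have "card (weight ?G ?f ` verts ?G) \<le> card (row_sum m n 0 ` {..<n})"
    by (intro card_mono) auto
  then have "card (weight ?G ?f ` verts ?G) \<le> n"
    using card_image_le[of "{..<n}" "row_sum m n 0"] by simp
  ultimately show ?thesis
    unfolding chi_lat_le_iff by blast
qed

theorem theorem2p8:
  fixes m n :: nat and k :: int
  assumes "m \<ge> 2" and "int n = 4 * k + 3" and "n \<ge> 3"
  shows "chi_lat (disjoint_copies m (complete_graph n)) \<le> enat (n + 1)"
proof -
  have "chi_lat (disjoint_copies m (complete_graph n)) \<le> enat n"
    using assms by (intro chi_lat_copies_le) simp
  also have "\<dots> \<le> enat (n + 1)" by simp
  finally show ?thesis .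
qed

end
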